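(* Let $0<p\le\infty$ and $0<\alpha<\infty$. No non-trivial semigroup of analytic functions induces a strongly continuous semigroup of composition operators on $H(p,\infty,\alpha)$. In other words, $[\varphi_t,H(p,\infty,\alpha)]\subsetneq H(p,\infty,\alpha)$ for every non-trivial semigroup of analytic functions $(\varphi_t)$.
   Context: A semigroup of analytic functions is a family $\{\varphi_t:t\ge0\}$ of analytic self-maps of the unit disk $\mathbb{D}$ with $\varphi_0=\mathrm{id}$, $\varphi_{t+s}=\varphi_t\circ\varphi_s$, and $\varphi_t\to\varphi_0$ uniformly on compact subsets as $t\to0^+$; it is trivial if all $\varphi_t$ are the identity. $M_p(r,f)=\left(\int_0^{2\pi}|f(re^{i\theta})|^p\frac{d\theta}{2\pi}\right)^{1/p}$ ($p<\infty$), $M_\infty(r,f)=\max_\theta|f(re^{i\theta})|$; $H(p,\infty,\alpha)$ is the space of analytic $f$ on $\mathbb{D}$ with $\|f\|_{p,\infty,\alpha}=\sup_{0\le r<1}(1-r)^\alpha M_p(r,f)<\infty$. For a space $X$, $[\varphi_t,X]=\{f\in X:\|f\circ\varphi_t-f\|_X\to0\text{ as }t\to0^+\}$. *)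

theory Defs
  imports "HOL-Analysis.Analysis" "HOL-Library.Extended_Real"
begin

abbreviation unit_disc :: "complex set" where
  "unit_disc \<equiv> ball 0 1"

definition analytic_semigroup :: "(real \<Rightarrow> complex \<Rightarrow> complex) \<Rightarrow> bool" where
  "analytic_semigroup \<phi> \<longleftrightarrow>
     (\<forall>t\<ge>0. \<phi> t holomorphic_on unit_disc \<and> \<phi> t ` unit_disc \<subseteq> unit_disc) \<and>
     (\<forall>z\<in>unit_disc. \<phi> 0 z = z) \<and>
     (\<forall>t\<ge>0. \<forall>s\<ge>0. \<forall>z\<in>unit_disc. \<phi> (t + s) z = \<phi> t (\<phi> s z)) \<and>
     (\<forall>K. compact K \<and> K \<subseteq> unit_disc \<longrightarrow> uniform_limit K \<phi> (\<phi> 0) (at_right 0))"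

definition trivial_semigroup :: "(real \<Rightarrow> complex \<Rightarrow> complex) \<Rightarrow> bool" where
  "trivial_semigroup \<phi> \<longleftrightarrow> (\<forall>t\<ge>0. \<forall>z\<in>unit_disc. \<phi> t z = z)"

definition Mp :: "ereal \<Rightarrow> real \<Rightarrow> (complex \<Rightarrow> complex) \<Rightarrow> real" where
  "Mp p r f =
     (if p = \<infinity> then (SUP \<theta>\<in>{0..2*pi}. norm (f (of_real r * cis \<theta>)))
      else (integral {0..2*pi} (\<lambda>\<theta>. norm (f (of_real r * cis \<theta>)) powr real_of_ereal p) / (2*pi))
             powr (1 / real_of_ereal p))"

definition Hnorm :: "ereal \<Rightarrow> real \<Rightarrow> (complex \<Rightarrow> complex) \<Rightarrow> ereal" where
  "Hnorm p \<alpha> f = (SUP r\<in>{0..<1}. ereal ((1 - r) powr \<alpha> * Mp p r f))"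

definition Hspace :: "ereal \<Rightarrow> real \<Rightarrow> (complex \<Rightarrow> complex) set" where
  "Hspace p \<alpha> = {f. f holomorphic_on unit_disc \<and> Hnorm p \<alpha> f < \<infinity>}"

definition strong_cont_space ::
  "(real \<Rightarrow> complex \<Rightarrow> complex) \<Rightarrow> ereal \<Rightarrow> real \<Rightarrow> (complex \<Rightarrow> complex) set" where
  "strong_cont_space \<phi> p \<alpha> =
     {f \<in> Hspace p \<alpha>. ((\<lambda>t. Hnorm p \<alpha> (\<lambda>z. f (\<phi> t z) - f z)) \<longlongrightarrow> 0) (at_right 0)}"

end

theory Submission
  imports Defs "HOL-Complex_Analysis.Complex_Analysis" "HOL-Real_Asymp.Real_Asymp"
begin

text \<open>
  Test on the monomials \<open>N\<^sup>\<alpha> z\<^sup>N\<close>, whose norms are bounded in \<open>N\<close>. If a self-map \<open>\<phi>\<close> of the disc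
  satisfied \<open>\<phi>\<^sup>N \<approx> z\<^sup>N\<close> in the mean on \<open>|z| = 1 - 1/n\<close> for all \<open>n \<le> N < 2n\<close>, then the
  factorization of \<open>\<phi>\<^sup>n (\<phi>\<^sup>n - z\<^sup>n)\<close> by \<open>\<phi> - z\<close> would force \<open>|\<phi> - z| \<le> C/n\<close> on a fixed proportion
  of that circle; by the subharmonicity of \<open>log |\<phi> - z|\<close> this is impossible for large \<open>n\<close> unless \<open>\<phi>\<close>
  is the identity. So, with a constant not depending on \<open>\<phi>\<close>, \<open>\<phi> \<noteq> id\<close> moves some monomial of
  arbitrarily large degree by a fixed amount. Applying this to \<open>\<phi>\<^sub>t\<close> for a sequence of times \<open>t \<longrightarrow> 0\<close>
  with \<open>\<phi>\<^sub>t \<noteq> id\<close>, and adding up monomials of rapidly increasing degrees, gives a function \<open>f\<close> of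
  the space with \<open>\<parallel>f \<circ> \<phi>\<^sub>t - f\<parallel>\<close> bounded below along that sequence.
\<close>

subsection \<open>Integral means over circles\<close>

lemma continuous_on_circle:
  assumes "continuous_on (sphere 0 r) f" "0 \<le> r"
  shows "continuous_on S (\<lambda>\<theta>. f (of_real r * cis \<theta>))"
  using assms
  by (intro continuous_on_compose2[OF assms(1)] continuous_intros) (auto simp: norm_mult)

lemma integrable_norm_circle:
  fixes f :: "complex \<Rightarrow> 'a::real_normed_vector"
  assumes "continuous_on (sphere 0 r) f" "0 \<le> r"
  shows "(\<lambda>\<theta>. norm (f (of_real r * cis \<theta>))) integrable_on {a..b}"
  using assms by (intro integrable_continuous_real continuous_intros continuous_on_circle)

lemma integrable_norm_powr_circle:
  fixes f :: "complex \<Rightarrow> 'a::real_normed_vector"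
  assumes "continuous_on (sphere 0 r) f" "0 \<le> r" "0 < q"
  shows "(\<lambda>\<theta>. norm (f (of_real r * cis \<theta>)) powr q) integrable_on {a..b}"
  using assms
  by (intro integrable_continuous_real continuous_on_powr' continuous_intros
      continuous_on_circle) auto

lemma Mp_one: "Mp 1 r f = integral {0..2*pi} (\<lambda>\<theta>. norm (f (of_real r * cis \<theta>))) / (2 * pi)"
proof -
  have "0 \<le> integral {0..2*pi} (\<lambda>\<theta>. norm (f (of_real r * cis \<theta>)))"
    by (cases "(\<lambda>\<theta>. norm (f (of_real r * cis \<theta>))) integrable_on {0..2*pi}")
       (auto simp: integral_nonneg not_integrable_integral)
  then show ?thesis
    by (simp add: Mp_def one_ereal_def)
qed

lemma Mp_one_cmult: "Mp 1 r (\<lambda>z. a * f z) = norm a * Mp 1 r f"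
  by (simp add: Mp_one norm_mult)

lemma sum_Mp_one:
  assumes "\<And>i. i \<in> I \<Longrightarrow> continuous_on (sphere 0 r) (f i)" "0 \<le> r"
  shows "(\<Sum>i\<in>I. Mp 1 r (f i))
    = integral {0..2*pi} (\<lambda>\<theta>. \<Sum>i\<in>I. norm (f i (of_real r * cis \<theta>))) / (2 * pi)"
proof (cases "finite I")
  case True
  then show ?thesis
    using assms
    by (simp add: Mp_one integral_sum integrable_norm_circle sum_divide_distrib)
qed simp

lemma Mp_one_le_add:
  assumes f: "continuous_on (sphere 0 r) f" and g: "continuous_on (sphere 0 r) g" and r: "0 \<le> r"
    and close: "\<And>z. norm z = r \<Longrightarrow> norm (f z - g z) \<le> e"
  shows "Mp 1 r f \<le> Mp 1 r g + e"
proof -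
  have "integral {0..2*pi} (\<lambda>\<theta>. norm (f (of_real r * cis \<theta>)))
      \<le> integral {0..2*pi} (\<lambda>\<theta>. norm (g (of_real r * cis \<theta>)) + e)"
  proof (rule integral_le)
    fix \<theta> :: real
    have "norm (f (of_real r * cis \<theta>) - g (of_real r * cis \<theta>)) \<le> e"
      using r by (intro close) (simp add: norm_mult)
    then show "norm (f (of_real r * cis \<theta>)) \<le> norm (g (of_real r * cis \<theta>)) + e"
      using norm_triangle_ineq2 order_trans by (smt (verit))
  qed (auto intro!: integrable_norm_circle integrable_add f g r)
  also have "\<dots> = integral {0..2*pi} (\<lambda>\<theta>. norm (g (of_real r * cis \<theta>))) + 2 * pi * e"
    using integral_add[OF integrable_norm_circle[OF g r] integrable_const_ivl] by simp
  finally show ?thesis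
    by (simp add: Mp_one field_simps)
qed

lemma Mp_le:
  assumes f: "continuous_on (sphere 0 r) f" and r: "0 \<le> r" and p: "0 < p"
    and B: "\<And>z. norm z = r \<Longrightarrow> norm (f z) \<le> B"
  shows "Mp p r f \<le> B"
proof (cases "p = \<infinity>")
  case True
  have "(SUP \<theta>\<in>{0..2*pi}. norm (f (of_real r * cis \<theta>))) \<le> B"
    using r by (intro cSUP_least B) (auto simp: norm_mult)
  with True show ?thesis
    by (simp add: Mp_def)
next
  case False
  with p obtain q where q: "p = ereal q" "0 < q"
    by (cases p) auto
  note int = integrable_norm_powr_circle[OF f r q(2)]
  have "0 \<le> B"
    using B[of "of_real r"] r norm_ge_zero[of "f (of_real r)"] by (simp del: norm_ge_zero)
  have "integral {0..2*pi} (\<lambda>\<theta>. norm (f (of_real r * cis \<theta>)) powr q)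
      \<le> integral {0..2*pi} (\<lambda>\<theta>. B powr q)"
    using r q by (intro integral_le int powr_mono2 B) (auto simp: norm_mult)
  then have "integral {0..2*pi} (\<lambda>\<theta>. norm (f (of_real r * cis \<theta>)) powr q) / (2 * pi) \<le> B powr q"
    by (simp add: field_simps)
  then have "(integral {0..2*pi} (\<lambda>\<theta>. norm (f (of_real r * cis \<theta>)) powr q) / (2 * pi)) powr (1 / q)
      \<le> (B powr q) powr (1 / q)"
    using q by (intro powr_mono2 divide_nonneg_nonneg integral_nonneg int) auto
  then show ?thesis
    using q \<open>0 \<le> B\<close> by (simp add: Mp_def powr_powr)
qed

lemma Mp_one_le_Mp_infinity:
  assumes f: "continuous_on (sphere 0 r) f" and r: "0 \<le> r"
  shows "Mp 1 r f \<le> Mp \<infinity> r f"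
proof -
  have "compact ((\<lambda>\<theta>. norm (f (of_real r * cis \<theta>))) ` {0..2*pi})"
    using f r by (intro compact_continuous_image continuous_intros continuous_on_circle) auto
  then have "bdd_above ((\<lambda>\<theta>. norm (f (of_real r * cis \<theta>))) ` {0..2*pi})"
    by (intro bounded_imp_bdd_above compact_imp_bounded)
  then have "norm (f (of_real r * cis \<theta>)) \<le> Mp \<infinity> r f" if "\<theta> \<in> {0..2*pi}" for \<theta>
    using that by (auto simp: Mp_def intro: cSUP_upper)
  then have "integral {0..2*pi} (\<lambda>\<theta>. norm (f (of_real r * cis \<theta>)))
      \<le> integral {0..2*pi} (\<lambda>_. Mp \<infinity> r f)"
    by (intro integral_le integrable_norm_circle f r) auto
  then show ?thesis
    by (simp add: Mp_one field_simps)
qed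

lemma le_add_mult_powr:
  fixes x \<delta> B q :: real
  assumes "0 < \<delta>" "0 \<le> q" "0 \<le> x" "x \<le> B"
  shows "x \<le> \<delta> + B / \<delta> powr q * x powr q"
proof (cases "x \<le> \<delta>")
  case True
  then show ?thesis
    using assms by (simp add: add_increasing2)
next
  case False
  then have "B * 1 \<le> B * (x / \<delta>) powr q"
    using assms by (intro mult_left_mono ge_one_powr_ge_zero) auto
  then show ?thesis
    using assms by (simp add: powr_divide)
qed

text \<open>The case \<^term>\<open>p = \<infinity>\<close> is covered by \<^prop>\<open>1 / real_of_ereal \<infinity> = 0\<close>.\<close>

lemma Mp_ge_of_Mp_one_ge:
  assumes f: "continuous_on (sphere 0 r) f" and r: "0 \<le> r" and p: "0 < p" and \<eta>: "0 < \<eta>"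
    and B: "0 < B" "\<And>z. norm z = r \<Longrightarrow> norm (f z) \<le> B" and mean: "\<eta> \<le> Mp 1 r f"
  shows "\<eta> / 2 * (\<eta> / (2 * B)) powr (1 / real_of_ereal p) \<le> Mp p r f"
proof (cases "p = \<infinity>")
  case True
  then show ?thesis
    using Mp_one_le_Mp_infinity[OF f r] mean \<eta> B(1) by simp
next
  case False
  with p obtain q where q: "p = ereal q" "0 < q"
    by (cases p) auto
  define \<delta> where "\<delta> = \<eta> / 2"
  have \<delta>: "0 < \<delta>"
    using \<eta> by (simp add: \<delta>_def)
  define I where "I = integral {0..2*pi} (\<lambda>\<theta>. norm (f (of_real r * cis \<theta>)) powr q) / (2 * pi)"
  note int = integrable_norm_powr_circle[OF f r q(2)]
  have "2 * pi * \<eta> \<le> integral {0..2*pi} (\<lambda>\<theta>. norm (f (of_real r * cis \<theta>)))"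
    using mean by (simp add: Mp_one field_simps)
  also have "\<dots> \<le> integral {0..2*pi} (\<lambda>\<theta>. \<delta> + B / \<delta> powr q * norm (f (of_real r * cis \<theta>)) powr q)"
    using r by (intro integral_le integrable_add integrable_on_mult_right int
        integrable_norm_circle f le_add_mult_powr B(2)) (use \<delta> q in \<open>auto simp: norm_mult\<close>)
  also have "\<dots> = 2 * pi * (\<delta> + B / \<delta> powr q * I)"
    using integral_add[OF integrable_const_ivl[of \<delta> 0 "2 * pi"]
        integrable_on_mult_right[OF int, of "B / \<delta> powr q"]]
    by (simp only: integral_mult_right I_def) (simp add: distrib_left)
  finally have "\<delta> powr q * (\<eta> / (2 * B)) \<le> I"
    using B(1) \<delta> by (simp add: \<delta>_def field_simps)
  then have "(\<delta> powr q * (\<eta> / (2 * B))) powr (1 / q) \<le> I powr (1 / q)"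
    using q \<delta> \<eta> B(1) by (intro powr_mono2) auto
  moreover have "(\<delta> powr q * (\<eta> / (2 * B))) powr (1 / q)
      = (\<delta> powr q) powr (1 / q) * (\<eta> / (2 * B)) powr (1 / q)"
    by (rule powr_mult)
  ultimately show ?thesis
    using q \<delta> by (simp add: Mp_def I_def powr_powr \<delta>_def)
qed

lemma Hnorm_le:
  assumes f: "continuous_on unit_disc f" and p: "0 < p"
    and growth: "\<And>z. z \<in> unit_disc \<Longrightarrow> (1 - norm z) powr \<alpha> * norm (f z) \<le> C"
  shows "Hnorm p \<alpha> f \<le> ereal C"
  unfolding Hnorm_def
proof (rule SUP_least)
  fix r :: real assume r: "r \<in> {0..<1}"
  have "Mp p r f \<le> C / (1 - r) powr \<alpha>"
  proof (rule Mp_le)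
    show "continuous_on (sphere 0 r) f"
      using r by (intro continuous_on_subset[OF f]) auto
    show "norm (f z) \<le> C / (1 - r) powr \<alpha>" if "norm z = r" for z
      using growth[of z] that r by (simp add: field_simps)
  qed (use r p in auto)
  then show "ereal ((1 - r) powr \<alpha> * Mp p r f) \<le> ereal C"
    using r by (simp add: field_simps)
qed

lemma mem_HspaceI:
  assumes "f holomorphic_on unit_disc" "0 < p"
    and "\<And>z. z \<in> unit_disc \<Longrightarrow> (1 - norm z) powr \<alpha> * norm (f z) \<le> C"
  shows "f \<in> Hspace p \<alpha>"
proof -
  have "Hnorm p \<alpha> f \<le> ereal C"
    using assms by (intro Hnorm_le holomorphic_on_imp_continuous_on)
  then show ?thesis
    using assms(1) by (auto simp: Hspace_def intro: le_less_trans)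
qed

lemma Hnorm_ge:
  assumes f: "continuous_on unit_disc f" and p: "0 < p" and r: "0 \<le> r" "r < 1"
    and \<eta>: "0 < \<eta>" "\<eta> \<le> (1 - r) powr \<alpha> * Mp 1 r f"
    and B: "0 < B" "\<And>z. norm z = r \<Longrightarrow> (1 - r) powr \<alpha> * norm (f z) \<le> B"
  shows "ereal (\<eta> / 2 * (\<eta> / (2 * B)) powr (1 / real_of_ereal p)) \<le> Hnorm p \<alpha> f"
proof -
  define s where "s = (1 - r) powr \<alpha>"
  have s: "0 < s"
    using r by (simp add: s_def)
  have "(\<eta> / s) / 2 * ((\<eta> / s) / (2 * (B / s))) powr (1 / real_of_ereal p) \<le> Mp p r f"
  proof (rule Mp_ge_of_Mp_one_ge)
    show "continuous_on (sphere 0 r) f"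
      using r by (intro continuous_on_subset[OF f]) auto
    show "\<eta> / s \<le> Mp 1 r f"
      using \<eta>(2) s by (simp add: s_def[symmetric] field_simps)
    show "norm (f z) \<le> B / s" if "norm z = r" for z
      using B(2)[OF that] s by (simp add: s_def[symmetric] field_simps)
  qed (use p r s \<eta> B in auto)
  then have "\<eta> / 2 * (\<eta> / (2 * B)) powr (1 / real_of_ereal p) \<le> (1 - r) powr \<alpha> * Mp p r f"
    using s by (simp add: s_def[symmetric] field_simps)
  then show ?thesis
    unfolding Hnorm_def using r by (intro SUP_upper2[of r]) auto
qed

subsection \<open>A lower bound for logarithmic means\<close>

lemma integral_periodic_shift:
  fixes F :: "real \<Rightarrow> 'a::banach"
  assumes cont: "continuous_on UNIV F" and per: "\<And>x. F (x + T) = F x" and s: "0 \<le> s" "s \<le> T"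
  shows "integral {s..s+T} F = integral {0..T} F"
proof -
  have int: "F integrable_on {a..b}" for a b
    using cont by (intro integrable_continuous_real continuous_on_subset[OF cont]) auto
  have "integral {s..s+T} F = integral {s..T} F + integral {T..s+T} F"
    using s int by (subst Henstock_Kurzweil_Integration.integral_combine) auto
  also have "integral {T..s+T} F = integral {0..s} F"
    using integral_shift_real_ivl[of T T "s+T" F] by (simp add: per)
  also have "integral {s..T} F + integral {0..s} F = integral {0..T} F"
    using s int by (subst add.commute, subst Henstock_Kurzweil_Integration.integral_combine) auto
  finally show ?thesis .
qed

lemma sum_integral_consecutive:
  fixes F :: "real \<Rightarrow> 'a::banach"
  assumes cont: "continuous_on UNIV F" and h: "0 \<le> h"
  shows "(\<Sum>j<m. integral {s + h * real j..s + h * real (Suc j)} F) = integral {s..s + h * real m} F"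
proof (induction m)
  case (Suc m)
  have "F integrable_on {s..s + h * real (Suc m)}"
    by (intro integrable_continuous_real continuous_on_subset[OF cont]) auto
  moreover have "s + h * real m \<le> s + h * real (Suc m)"
    using h by (simp add: algebra_simps)
  ultimately show ?case
    using Suc h by (simp add: Henstock_Kurzweil_Integration.integral_combine del: of_nat_Suc)
qed auto

definition left_Riemann_sum :: "(real \<Rightarrow> 'a::real_vector) \<Rightarrow> real \<Rightarrow> real \<Rightarrow> nat \<Rightarrow> 'a" where
  "left_Riemann_sum F s h m = (\<Sum>j<m. h *\<^sub>R F (s + h * real j))"

lemma norm_left_Riemann_sum_minus_integral_le:
  fixes F :: "real \<Rightarrow> 'a::banach"
  assumes cont: "continuous_on UNIV F" and h: "0 \<le> h"
    and osc: "\<And>x y. \<lbrakk>x \<in> {s..s + h * real m}; y \<in> {s..s + h * real m}; \<bar>x - y\<bar> \<le> h\<rbrakk>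
      \<Longrightarrow> norm (F x - F y) \<le> e"
  shows "norm (left_Riemann_sum F s h m - integral {s..s + h * real m} F) \<le> h * real m * e"
proof -
  let ?I = "\<lambda>j. {s + h * real j..s + h * real (Suc j)}"
  have cell: "norm (h *\<^sub>R F (s + h * real j) - integral (?I j) F) \<le> h * e" if "j < m" for j
  proof -
    have "0 \<le> h * real j" "h * real (Suc j) \<le> h * real m"
      using that h by (auto intro!: mult_left_mono)
    then have "?I j \<subseteq> {s..s + h * real m}"
      unfolding atLeastatMost_subset_iff by linarith
    moreover have "s + h * real j \<in> ?I j"
      using h by (simp add: mult_left_mono)
    ultimately have "norm (F (s + h * real j) - F x) \<le> e" if "x \<in> ?I j" for x
      using that by (intro osc subsetD[OF \<open>?I j \<subseteq> _\<close>]) (auto simp: algebra_simps)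
    then have "norm (integral (?I j) (\<lambda>x. F (s + h * real j) - F x))
        \<le> e * (s + h * real (Suc j) - (s + h * real j))"
      using h by (intro integral_bound continuous_intros continuous_on_subset[OF cont])
        (auto simp: algebra_simps)
    also have "integral (?I j) (\<lambda>x. F (s + h * real j) - F x)
        = h *\<^sub>R F (s + h * real j) - integral (?I j) F"
      using h by (subst integral_diff) (auto intro!: integrable_continuous_real
          continuous_on_subset[OF cont] simp: algebra_simps)
    finally show ?thesis
      by (simp add: algebra_simps)
  qed
  have "norm (\<Sum>j<m. h *\<^sub>R F (s + h * real j) - integral (?I j) F) \<le> (\<Sum>j<m. h * e)"
    using cell by (intro sum_norm_le) auto
  then show ?thesis
    by (simp add: left_Riemann_sum_def sum_subtractf sum_integral_consecutive[OF cont h] mult_ac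
        del: of_nat_Suc)
qed

lemma uniform_limit_periodic_Riemann_sum:
  fixes F :: "real \<Rightarrow> 'a::banach"
  assumes cont: "continuous_on UNIV F" and T: "0 < T" and per: "\<And>x. F (x + T) = F x"
  shows "uniform_limit {0..T} (\<lambda>m s. left_Riemann_sum F s (T / real m) m)
    (\<lambda>_. integral {0..T} F) sequentially"
proof (rule uniform_limitI)
  fix e :: real assume "0 < e"
  define e' where "e' = e / (2 * T)"
  have e': "0 < e'" "T * e' < e"
    using \<open>0 < e\<close> T by (auto simp: e'_def)
  have "uniformly_continuous_on {0..2*T} F"
    by (intro compact_uniformly_continuous continuous_on_subset[OF cont]) auto
  then obtain d where d: "0 < d"
    "\<And>x y. x \<in> {0..2*T} \<Longrightarrow> y \<in> {0..2*T} \<Longrightarrow> dist x y < d \<Longrightarrow> dist (F x) (F y) < e'"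
    using e' unfolding uniformly_continuous_on_def by metis
  have "(\<lambda>m. T / real m) \<longlonglongrightarrow> 0"
    by real_asymp
  then have "\<forall>\<^sub>F m in sequentially. T / real m < d"
    using d(1) by (rule order_tendstoD)
  then show "\<forall>\<^sub>F m in sequentially. \<forall>s\<in>{0..T}.
      dist (left_Riemann_sum F s (T / real m) m) (integral {0..T} F) < e"
    using eventually_gt_at_top[of 0]
  proof (eventually_elim, intro ballI)
    fix m :: nat and s assume m: "T / real m < d" "0 < m" and s: "s \<in> {0..T}"
    have "norm (left_Riemann_sum F s (T / real m) m - integral {s..s + T / real m * real m} F)
        \<le> T / real m * real m * e'"
    proof (rule norm_left_Riemann_sum_minus_integral_le[OF cont])
      fix x y assume "x \<in> {s..s + T / real m * real m}" "y \<in> {s..s + T / real m * real m}"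
        "\<bar>x - y\<bar> \<le> T / real m"
      with s m show "norm (F x - F y) \<le> e'"
        using d(2)[of x y] by (auto simp: dist_norm)
    qed (use T in auto)
    with m e' s show "dist (left_Riemann_sum F s (T / real m) m) (integral {0..T} F) < e"
      by (simp add: integral_periodic_shift[OF cont per] dist_norm)
  qed
qed

lemma holomorphic_lower_bound_on_circle:
  assumes g: "g holomorphic_on ball 0 R" and w: "w \<in> ball 0 R" "g w \<noteq> 0"
  obtains \<rho> c where "0 < \<rho>" "\<rho> < R" "0 < c" "\<And>z. norm z = \<rho> \<Longrightarrow> c \<le> norm (g z)"
proof -
  have "0 < R"
    using w(1) by (metis ball_eq_empty empty_iff not_less)
  then have "\<forall>\<^sub>F z in at 0. g z \<noteq> 0 \<and> z \<in> ball 0 R"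
    using g w by (intro non_zero_neighbour_alt) auto
  then obtain d where d: "0 < d" "\<And>z. z \<noteq> 0 \<Longrightarrow> norm z < d \<Longrightarrow> g z \<noteq> 0 \<and> norm z < R"
    by (auto simp: eventually_at)
  define \<rho> where "\<rho> = min d R / 2"
  have \<rho>: "0 < \<rho>" "\<rho> < d" "\<rho> < R"
    using d(1) \<open>0 < R\<close> by (auto simp: \<rho>_def)
  have "continuous_on (sphere 0 \<rho>) (\<lambda>z. norm (g z))"
    using \<rho> by (intro continuous_intros
        continuous_on_subset[OF holomorphic_on_imp_continuous_on[OF g]]) auto
  then obtain x where x: "x \<in> sphere 0 \<rho>" "\<And>y. y \<in> sphere 0 \<rho> \<Longrightarrow> norm (g x) \<le> norm (g y)"
    using continuous_attains_inf[of "sphere 0 \<rho>" "\<lambda>z. norm (g z)"] \<rho> by auto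
  have "g x \<noteq> 0"
    using d(2)[of x] x(1) \<rho> by auto
  with x \<rho> show ?thesis
    by (intro that[of \<rho> "norm (g x)"]) auto
qed

lemma maximum_modulus_prod_rotations:
  assumes g: "g holomorphic_on ball 0 R" and \<rho>: "0 \<le> \<rho>" "\<rho> \<le> r" "r < R"
    and c: "0 \<le> c" "\<And>z. norm z = \<rho> \<Longrightarrow> c \<le> norm (g z)"
  obtains s where "s \<in> {0..2*pi}"
    "c ^ m \<le> (\<Prod>j<m. norm (g (of_real r * cis (s + 2 * pi / real m * real j))))"
proof -
  define P where "P z = (\<Prod>j<m. g (cis (2 * pi / real m * real j) * z))" for z
  have holP: "P holomorphic_on ball 0 R"
    unfolding P_def
    by (intro holomorphic_intros holomorphic_on_compose_gen[OF _ g, unfolded o_def])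
      (auto simp: norm_mult)
  then have contP: "continuous_on (cball 0 r) P"
    using \<rho> by (intro continuous_on_subset[OF holomorphic_on_imp_continuous_on]) auto
  have "continuous_on (sphere 0 r) (\<lambda>z. norm (P z))" "of_real r \<in> sphere (0::complex) r"
    using \<rho> by (auto intro!: continuous_intros continuous_on_subset[OF contP])
  then obtain w where w: "w \<in> sphere 0 r" "\<And>z. z \<in> sphere 0 r \<Longrightarrow> norm (P z) \<le> norm (P w)"
    using continuous_attains_sup[of "sphere 0 r" "\<lambda>z. norm (P z)"]
    by (metis compact_sphere empty_iff)
  have "c ^ m = (\<Prod>j<m. c)"
    by simp
  also have "\<dots> \<le> norm (P (of_real \<rho>))"
    unfolding P_def prod_norm[symmetric] using c \<rho> by (intro prod_mono) (auto simp: norm_mult)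
  also have "\<dots> \<le> norm (P w)"
  proof (rule maximum_modulus_frontier[of P "cball 0 r"])
    show "P holomorphic_on interior (cball 0 r)"
      using \<rho> by (intro holomorphic_on_subset[OF holP]) auto
    show "norm (P z) \<le> norm (P w)" if "z \<in> frontier (cball 0 r)" for z
      using w that \<rho> by (auto simp: frontier_cball)
  qed (use \<rho> contP in auto)
  also have "w = of_real r * cis (Arg2pi w)"
    using Arg2pi_eq[of w] w(1) by (simp add: cis_conv_exp)
  then have "norm (P w) = (\<Prod>j<m. norm (g (of_real r * cis (Arg2pi w + 2 * pi / real m * real j))))"
    unfolding P_def prod_norm[symmetric]
    by (intro prod.cong refl arg_cong[where f = "\<lambda>z. norm (g z)"])
       (metis cis_mult mult.commute mult.left_commute)
  finally show ?thesis
    using Arg2pi_ge_0[of w] Arg2pi_lt_2pi[of w] by (intro that[of "Arg2pi w"]) auto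
qed

lemma holomorphic_lower_bound_le_exp_Riemann_sum:
  fixes A :: "real \<Rightarrow> real"
  assumes g: "g holomorphic_on ball 0 R" and \<rho>: "0 \<le> \<rho>" "\<rho> \<le> r" "r < R"
    and c: "0 \<le> c" "\<And>z. norm z = \<rho> \<Longrightarrow> c \<le> norm (g z)"
    and majorant: "\<And>\<theta>. norm (g (of_real r * cis \<theta>)) \<le> exp (A \<theta>)" and m: "0 < m"
  shows "\<exists>s\<in>{0..2*pi}. c \<le> exp (left_Riemann_sum A s (2 * pi / real m) m / (2 * pi))"
proof -
  obtain s where s: "s \<in> {0..2*pi}"
    "c ^ m \<le> (\<Prod>j<m. norm (g (of_real r * cis (s + 2 * pi / real m * real j))))"
    using maximum_modulus_prod_rotations[OF g \<rho> c] by blast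
  define S where "S = (\<Sum>j<m. A (s + 2 * pi / real m * real j))"
  have "c ^ m \<le> (\<Prod>j<m. exp (A (s + 2 * pi / real m * real j)))"
    using majorant by (intro order_trans[OF s(2)] prod_mono) auto
  also have "\<dots> = exp (S / real m) ^ m"
    using m by (simp add: S_def exp_sum[symmetric] exp_of_nat_mult[symmetric])
  finally have "c \<le> exp (S / real m)"
    using m c(1) by (simp add: power_mono_iff)
  then show ?thesis
    using s(1) by (auto simp: left_Riemann_sum_def S_def sum_divide_distrib)
qed

text \<open>Jensen's inequality without logarithms or zero counting: the maximum principle is applied to
  the product of the rotates of \<^term>\<open>g\<close> by all \<^term>\<open>m\<close>-th roots of unity, and \<^term>\<open>m\<close> tends to
  infinity.\<close>

lemma holomorphic_lower_bound_le_exp_mean: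
  fixes A :: "real \<Rightarrow> real"
  assumes g: "g holomorphic_on ball 0 R" and \<rho>: "0 \<le> \<rho>" "\<rho> \<le> r" "r < R"
    and c: "0 \<le> c" "\<And>z. norm z = \<rho> \<Longrightarrow> c \<le> norm (g z)"
    and cont: "continuous_on UNIV A" and per: "\<And>\<theta>. A (\<theta> + 2 * pi) = A \<theta>"
    and majorant: "\<And>\<theta>. norm (g (of_real r * cis \<theta>)) \<le> exp (A \<theta>)"
  shows "c \<le> exp (integral {0..2*pi} A / (2 * pi))"
proof -
  let ?I = "integral {0..2*pi} A"
  have "c \<le> exp ((?I + e) / (2 * pi))" if "0 < e" for e
  proof -
    have "\<forall>\<^sub>F m in sequentially. \<forall>s\<in>{0..2*pi}.
        dist (left_Riemann_sum A s (2 * pi / real m) m) ?I < e"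
      using uniform_limitD[OF uniform_limit_periodic_Riemann_sum[OF cont _ per] that] by simp
    then have "\<forall>\<^sub>F m in sequentially. 0 < m \<and> (\<forall>s\<in>{0..2*pi}.
        dist (left_Riemann_sum A s (2 * pi / real m) m) ?I < e)"
      by (intro eventually_conj eventually_gt_at_top)
    then obtain m where m: "0 < m" "\<And>s. s \<in> {0..2*pi} \<Longrightarrow>
        dist (left_Riemann_sum A s (2 * pi / real m) m) ?I < e"
      using eventually_happens'[OF sequentially_bot] by blast
    obtain s where s: "s \<in> {0..2*pi}"
      "c \<le> exp (left_Riemann_sum A s (2 * pi / real m) m / (2 * pi))"
      using holomorphic_lower_bound_le_exp_Riemann_sum[OF g \<rho> c majorant m(1)] by blast
    have "left_Riemann_sum A s (2 * pi / real m) m \<le> ?I + e"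
      using m(2)[OF s(1)] by (simp add: dist_real_def)
    then show ?thesis
      by (intro order_trans[OF s(2)]) (simp add: divide_right_mono)
  qed
  then have "\<forall>\<^sub>F e in at_right 0. c \<le> exp ((?I + e) / (2 * pi))"
    by (intro eventually_mono[OF eventually_at_right_less]) auto
  moreover have "((\<lambda>e. exp ((?I + e) / (2 * pi))) \<longlongrightarrow> exp (?I / (2 * pi))) (at_right 0)"
    by (auto intro!: tendsto_eq_intros)
  ultimately show ?thesis
    by (intro tendsto_lowerbound) auto
qed

subsection \<open>Powers of a self-map of the disc\<close>

lemma diff_mult_power_sum:
  fixes a z :: "'a::comm_ring_1"
  shows "(a - z) * (\<Sum>N=n..<2*n. a ^ N * z ^ (2 * n - 1 - N)) = a ^ n * (a ^ n - z ^ n)"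
proof -
  have "(a - z) * (\<Sum>N=n..<2*n. a ^ N * z ^ (2 * n - 1 - N))
      = a ^ n * ((a - z) * (\<Sum>k<n. z ^ (n - Suc k) * a ^ k))"
    by (simp add: sum_distrib_left sum.atLeastLessThan_shift_0[of _ n] power_add
        mult_ac mult_2 lessThan_atLeast0)
  then show ?thesis
    by (simp add: power_diff_sumr2)
qed

text \<open>The factor \<^term>\<open>a ^ n\<close> multiplying the divided difference of the powers keeps all the
  exponents in \<open>{n..<2*n}\<close>, where the test functions are seen at radius \<open>1 - 1/n\<close>.\<close>

lemma norm_diff_mult_power_sum_le:
  fixes a z :: "'a::real_normed_field"
  assumes "norm a \<le> 1" "norm z \<le> 1"
  shows "norm (a - z) * (real n * norm z ^ (2 * n - 1) - (\<Sum>N=n..<2*n. norm (a ^ N - z ^ N))) \<le> 2"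
proof -
  define K where "K = (\<Sum>N=n..<2*n. a ^ N * z ^ (2 * n - 1 - N))"
  have "norm (a - z) * norm K = norm a ^ n * norm (a ^ n - z ^ n)"
    using arg_cong[OF diff_mult_power_sum[of a z n], of norm]
    by (simp add: K_def norm_mult norm_power)
  also have "\<dots> \<le> 1 * (1 + 1)"
    using assms
    by (intro mult_mono power_le_one order_trans[OF norm_triangle_ineq4] add_mono)
       (auto simp: norm_power power_le_one)
  finally have K: "norm (a - z) * norm K \<le> 2"
    by simp
  have "of_nat n * z ^ (2 * n - 1) = (\<Sum>N=n..<2*n. z ^ N * z ^ (2 * n - 1 - N))"
    by (simp add: power_add[symmetric])
  then have "of_nat n * z ^ (2 * n - 1) - K = (\<Sum>N=n..<2*n. (z ^ N - a ^ N) * z ^ (2 * n - 1 - N))"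
    by (simp add: K_def sum_subtractf left_diff_distrib)
  also have "norm \<dots> \<le> (\<Sum>N=n..<2*n. norm (a ^ N - z ^ N))"
  proof (rule sum_norm_le)
    fix N
    have "norm (z ^ N - a ^ N) * norm (z ^ (2 * n - 1 - N)) \<le> norm (z ^ N - a ^ N) * 1"
      using assms by (intro mult_left_mono) (auto simp: norm_power power_le_one)
    then show "norm ((z ^ N - a ^ N) * z ^ (2 * n - 1 - N)) \<le> norm (a ^ N - z ^ N)"
      by (simp add: norm_mult norm_minus_commute)
  qed
  finally have "norm (of_nat n * z ^ (2 * n - 1)) - norm K \<le> (\<Sum>N=n..<2*n. norm (a ^ N - z ^ N))"
    using norm_triangle_ineq2 order_trans by blast
  then have "real n * norm z ^ (2 * n - 1) - (\<Sum>N=n..<2*n. norm (a ^ N - z ^ N)) \<le> norm K"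
    by (simp add: norm_mult norm_power)
  then show ?thesis
    using K mult_left_mono[of _ "norm K" "norm (a - z)"] by (meson norm_ge_zero order_trans)
qed

text \<open>Whether the average is below or above \<^term>\<open>\<kappa> / 2\<close>, the bound takes the same form, which is
  affine in the average after taking logarithms.\<close>

lemma norm_diff_le_powr_average:
  fixes a z :: "'a::real_normed_field" and \<kappa> :: real
  assumes norms: "norm a \<le> 1" "norm z \<le> 1"
    and \<kappa>: "0 < \<kappa>" "\<kappa> \<le> norm z ^ (2 * n - 1)" "2 / \<kappa> \<le> real n"
  defines "avg \<equiv> (\<Sum>N=n..<2*n. norm (a ^ N - z ^ N)) / real n"
  shows "norm (a - z) \<le> 2 * (2 / (\<kappa> * real n)) powr (1 - 2 / \<kappa> * avg)"
proof -
  define y where "y = 2 / (\<kappa> * real n)"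
  have n: "0 < real n"
    using \<kappa>(3) less_le_trans[OF divide_pos_pos[OF zero_less_numeral \<kappa>(1)]] by blast
  have y: "0 < y" "y \<le> 1"
    using n \<kappa> by (auto simp: y_def field_simps)
  have avg: "0 \<le> avg" "real n * avg = (\<Sum>N=n..<2*n. norm (a ^ N - z ^ N))"
    using n by (auto simp: avg_def sum_nonneg)
  have "norm (a - z) \<le> 2 * y powr (1 - 2 / \<kappa> * avg)"
  proof (cases "avg \<le> \<kappa> / 2")
    case True
    have "norm (a - z) * (real n * (\<kappa> / 2))
        \<le> norm (a - z) * (real n * (norm z ^ (2 * n - 1) - avg))"
      using True \<kappa>(2) by (intro mult_left_mono) auto
    also have "\<dots> \<le> 2"
      using norm_diff_mult_power_sum_le[OF norms, of n] by (simp add: right_diff_distrib avg(2))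
    finally have "norm (a - z) \<le> 2 * y powr 1"
      using n \<kappa>(1) y by (simp add: y_def field_simps)
    also have "\<dots> \<le> 2 * y powr (1 - 2 / \<kappa> * avg)"
      using y \<kappa>(1) avg(1) by (intro mult_left_mono powr_mono') auto
    finally show ?thesis .
  next
    case False
    have "norm (a - z) \<le> 2 * y powr 0"
      using norm_triangle_ineq4[of a z] norms y by simp
    also have "\<dots> \<le> 2 * y powr (1 - 2 / \<kappa> * avg)"
      using y \<kappa>(1) False by (intro mult_left_mono powr_mono') (auto simp: field_simps)
    finally show ?thesis .
  qed
  then show ?thesis
    by (simp add: y_def)
qed

lemma holomorphic_lower_bound_le_powr_mean:
  fixes a :: "real \<Rightarrow> real"
  assumes g: "g holomorphic_on ball 0 R" and \<rho>: "0 \<le> \<rho>" "\<rho> \<le> r" "r < R"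
    and c: "0 \<le> c" "\<And>z. norm z = \<rho> \<Longrightarrow> c \<le> norm (g z)"
    and cont: "continuous_on UNIV a" and per: "\<And>\<theta>. a (\<theta> + 2 * pi) = a \<theta>"
    and pos: "0 < C" "0 < y"
    and majorant: "\<And>\<theta>. norm (g (of_real r * cis \<theta>)) \<le> C * y powr (b - k * a \<theta>)"
  shows "c \<le> C * y powr (b - k * (integral {0..2*pi} a / (2 * pi)))"
proof -
  define A where "A \<theta> = (ln C + b * ln y) - k * ln y * a \<theta>" for \<theta>
  have exp_A: "C * y powr (b - k * x) = exp ((ln C + b * ln y) - k * ln y * x)" for x
  proof -
    have "C * y powr (b - k * x) = exp (ln C) * exp ((b - k * x) * ln y)"
      using pos by (simp add: powr_def)
    then show ?thesis
      by (simp add: exp_add[symmetric] algebra_simps)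
  qed
  have "(a has_integral integral {0..2*pi} a) {0..2*pi}"
    by (intro integrable_integral integrable_continuous_real continuous_on_subset[OF cont]) auto
  then have "(A has_integral (2 * pi) * (ln C + b * ln y) - k * ln y * integral {0..2*pi} a)
      {0..2*pi}"
    using has_integral_diff[OF has_integral_const_real[of "ln C + b * ln y" 0 "2 * pi"]
        has_integral_mult_right[of a _ _ "k * ln y"]]
    by (simp add: A_def[abs_def])
  then have mean_A: "integral {0..2*pi} A / (2 * pi)
      = (ln C + b * ln y) - k * ln y * (integral {0..2*pi} a / (2 * pi))"
    by (simp add: integral_unique diff_divide_distrib)
  have "c \<le> exp (integral {0..2*pi} A / (2 * pi))"
    using majorant per cont
    by (intro holomorphic_lower_bound_le_exp_mean[OF g \<rho> c])
       (auto simp: A_def exp_A intro!: continuous_intros)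
  then show ?thesis
    unfolding mean_A exp_A .
qed

lemma displacement_le_powr_mean_Mp_one:
  assumes hol: "\<phi> holomorphic_on unit_disc" and into: "\<phi> ` unit_disc \<subseteq> unit_disc"
    and \<rho>: "0 \<le> \<rho>" "\<rho> \<le> r" "r < 1" and c: "0 \<le> c" "\<And>z. norm z = \<rho> \<Longrightarrow> c \<le> norm (\<phi> z - z)"
    and \<kappa>: "0 < \<kappa>" "\<kappa> \<le> r ^ (2 * n - 1)" "2 / \<kappa> \<le> real n" and n: "0 < n"
  shows "c \<le> 2 * (2 / (\<kappa> * real n)) powr
    (1 - 2 / \<kappa> * ((\<Sum>N=n..<2*n. Mp 1 r (\<lambda>z. \<phi> z ^ N - z ^ N)) / real n))"
proof -
  let ?d = "\<lambda>N z. \<phi> z ^ N - z ^ N"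
  define z where "z \<theta> = of_real r * cis \<theta>" for \<theta>
  have norm_z: "norm (z \<theta>) = r" for \<theta>
    using \<rho> by (simp add: z_def norm_mult)
  define avg where "avg \<theta> = (\<Sum>N=n..<2*n. norm (?d N (z \<theta>))) / real n" for \<theta>
  have cont_d: "continuous_on (sphere 0 r) (?d N)" for N
    using \<rho> by (intro continuous_intros
        continuous_on_subset[OF holomorphic_on_imp_continuous_on[OF hol]]) auto
  have "c \<le> 2 * (2 / (\<kappa> * real n)) powr (1 - 2 / \<kappa> * (integral {0..2*pi} avg / (2 * pi)))"
  proof (rule holomorphic_lower_bound_le_powr_mean[where g = "\<lambda>z. \<phi> z - z"
        and R = 1 and r = r and \<rho> = \<rho>])
    show "continuous_on UNIV avg"
      unfolding avg_def z_def using n \<rho>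
      by (intro continuous_intros continuous_on_circle[OF cont_d]) auto
    show "norm (\<phi> (of_real r * cis \<theta>) - of_real r * cis \<theta>)
        \<le> 2 * (2 / (\<kappa> * real n)) powr (1 - 2 / \<kappa> * avg \<theta>)" for \<theta>
    proof -
      have "norm (\<phi> (z \<theta>)) \<le> 1"
        using into norm_z[of \<theta>] \<rho> by (force simp: image_subset_iff)
      then show ?thesis
        unfolding avg_def z_def[symmetric]
        using \<kappa> \<rho> by (intro norm_diff_le_powr_average) (auto simp: norm_z)
    qed
  qed (use \<rho> c \<kappa> n in \<open>auto simp: avg_def z_def cis_mult[symmetric] intro!: holomorphic_intros hol\<close>)
  moreover have "integral {0..2*pi} avg / (2 * pi) = (\<Sum>N=n..<2*n. Mp 1 r (?d N)) / real n"
    using sum_Mp_one[of "{n..<2*n}" r ?d] cont_d \<rho> by (simp add: avg_def[abs_def] z_def)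
  ultimately show ?thesis
    by simp
qed

lemma ex_power_displacement_ge:
  assumes hol: "\<phi> holomorphic_on unit_disc" and into: "\<phi> ` unit_disc \<subseteq> unit_disc"
    and \<rho>: "0 \<le> \<rho>" "\<rho> \<le> r" "r < 1" and c: "\<And>z. norm z = \<rho> \<Longrightarrow> c \<le> norm (\<phi> z - z)"
    and \<kappa>: "0 < \<kappa>" "\<kappa> \<le> r ^ (2 * n - 1)" "2 / \<kappa> \<le> real n"
    and large: "2 * sqrt (2 / (\<kappa> * real n)) < c"
  shows "\<exists>N\<in>{n..<2*n}. \<kappa> / 4 \<le> Mp 1 r (\<lambda>z. \<phi> z ^ N - z ^ N)"
proof (rule ccontr)
  let ?mean = "(\<Sum>N=n..<2*n. Mp 1 r (\<lambda>z. \<phi> z ^ N - z ^ N)) / real n"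
  assume "\<not> ?thesis"
  then have small: "Mp 1 r (\<lambda>z. \<phi> z ^ N - z ^ N) \<le> \<kappa> / 4" if "N \<in> {n..<2*n}" for N
    using that by (meson linear)
  define y where "y = 2 / (\<kappa> * real n)"
  have n: "0 < real n"
    using \<kappa>(3) less_le_trans[OF divide_pos_pos[OF zero_less_numeral \<kappa>(1)]] by blast
  have y: "0 < y" "y \<le> 1"
    using n \<kappa> by (auto simp: y_def field_simps)
  have "?mean \<le> (real (card {n..<2*n}) * (\<kappa> / 4)) / real n"
    using small n by (intro divide_right_mono sum_bounded_above) auto
  then have mean: "?mean \<le> \<kappa> / 4"
    using n by simp
  have "0 \<le> c"
    using large y by (intro order_trans[OF _ less_imp_le[OF large]]) (auto simp: y_def)
  then have "c \<le> 2 * y powr (1 - 2 / \<kappa> * ?mean)"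
    unfolding y_def using n by (intro displacement_le_powr_mean_Mp_one[OF hol into \<rho> _ c \<kappa>]) auto
  also have "\<dots> \<le> 2 * y powr (1 / 2)"
  proof -
    have "2 / \<kappa> * ?mean \<le> 2 / \<kappa> * (\<kappa> / 4)"
      using mean \<kappa>(1) by (intro mult_left_mono) auto
    then have "1 / 2 \<le> 1 - 2 / \<kappa> * ?mean"
      using \<kappa>(1) by simp
    then show ?thesis
      using y by (intro mult_left_mono powr_mono') auto
  qed
  finally show False
    using large y by (simp add: y_def powr_half_sqrt)
qed

lemma one_minus_inverse_power_ge:
  assumes "2 \<le> n"
  shows "exp (- 4) \<le> (1 - 1 / real n) ^ (2 * n - 1)"
proof -
  define x where "x = 1 / real n"
  have x: "0 < x" "x \<le> 1 / 2"
    using assms by (auto simp: x_def field_simps)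
  have "x * x \<le> (1 / 2) * x"
    using x by (intro mult_right_mono) auto
  then have "- (2 * x) \<le> ln (1 - x)"
    using ln_one_minus_pos_lower_bound[of x] x unfolding power2_eq_square by linarith
  then have "exp (- (2 * x)) \<le> 1 - x"
    using x by (subst (asm) ln_ge_iff) auto
  then have "exp (- (2 * x)) ^ (2 * n) \<le> (1 - x) ^ (2 * n)"
    by (intro power_mono) auto
  also have "\<dots> \<le> (1 - x) ^ (2 * n - 1)"
    using x by (intro power_decreasing) auto
  also have "exp (- (2 * x)) ^ (2 * n) = exp (- 4)"
    using assms by (simp add: exp_of_nat_mult[symmetric] x_def)
  finally show ?thesis
    by (simp add: x_def)
qed

lemma eventually_power_displacement_ge:
  assumes hol: "\<phi> holomorphic_on unit_disc" and into: "\<phi> ` unit_disc \<subseteq> unit_disc"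
    and w: "w \<in> unit_disc" "\<phi> w \<noteq> w"
  shows "\<forall>\<^sub>F n in sequentially. \<exists>N\<in>{n..<2*n}.
    exp (- 4) / 4 \<le> Mp 1 (1 - 1 / real n) (\<lambda>z. \<phi> z ^ N - z ^ N)"
proof -
  obtain \<rho> c where \<rho>: "0 < \<rho>" "\<rho> < 1" and c: "0 < c" "\<And>z. norm z = \<rho> \<Longrightarrow> c \<le> norm (\<phi> z - z)"
    using holomorphic_lower_bound_on_circle[OF holomorphic_on_diff[OF hol holomorphic_on_ident]
        w(1)] w(2) by auto
  have "\<forall>\<^sub>F n in sequentially. \<rho> < 1 - 1 / real n"
    using \<rho>(2) by real_asymp
  moreover have "\<forall>\<^sub>F n in sequentially. 2 * sqrt (2 / (exp (- 4) * real n)) < c"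
    using c(1) by real_asymp
  moreover have "\<forall>\<^sub>F n in sequentially. 2 / exp (- 4) \<le> real n"
    by real_asymp
  ultimately show ?thesis
    using eventually_ge_at_top[of 2]
  proof eventually_elim
    case (elim n)
    then show ?case
      using \<rho> c(2) one_minus_inverse_power_ge[of n]
      by (intro ex_power_displacement_ge[OF hol into, where \<rho> = \<rho> and c = c]) auto
  qed
qed

subsection \<open>Gliding humps\<close>

text \<open>The second bound says that \<^term>\<open>u\<close> grows no further beyond the circle of radius \<^term>\<open>r\<close>.\<close>

definition hump :: "real \<Rightarrow> real \<Rightarrow> real \<Rightarrow> (complex \<Rightarrow> complex) \<Rightarrow> bool" where
  "hump \<alpha> A r u \<longleftrightarrow> u holomorphic_on unit_disc \<and>
     (\<forall>z\<in>unit_disc. (1 - norm z) powr \<alpha> * norm (u z) \<le> A \<and> (1 - r) powr \<alpha> * norm (u z) \<le> A)"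

lemma hump_holomorphic: "hump \<alpha> A r u \<Longrightarrow> u holomorphic_on unit_disc"
  and hump_growth: "hump \<alpha> A r u \<Longrightarrow> z \<in> unit_disc \<Longrightarrow> (1 - norm z) powr \<alpha> * norm (u z) \<le> A"
  and hump_peak: "hump \<alpha> A r u \<Longrightarrow> z \<in> unit_disc \<Longrightarrow> (1 - r) powr \<alpha> * norm (u z) \<le> A"
  by (auto simp: hump_def)

lemma hump_bound_nonneg: "hump \<alpha> A r u \<Longrightarrow> 0 \<le> A"
  using hump_growth[of \<alpha> A r u 0] order_trans[OF norm_ge_zero] by simp

locale gliding_humps =
  fixes \<alpha> A c :: real and u :: "nat \<Rightarrow> complex \<Rightarrow> complex" and r \<rho> :: "nat \<Rightarrow> real"
  assumes \<alpha>_ge_0: "0 \<le> \<alpha>" and c_gt_0: "0 < c"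
    and hump: "hump \<alpha> A (r k) (u k)"
    and r_ge_0: "0 \<le> r k" and r_le_\<rho>: "r k \<le> \<rho> k" and \<rho>_less_1: "\<rho> k < 1"
    and \<rho>_exhausts: "x < 1 \<Longrightarrow> \<exists>k. x \<le> \<rho> k"
    and head_le: "z \<in> unit_disc \<Longrightarrow> (1 - r k) powr \<alpha> * (\<Sum>i<k. norm (u i z)) \<le> c"
    and tail_le: "i < k \<Longrightarrow> norm z \<le> \<rho> i \<Longrightarrow> norm (u k z) \<le> c * (1 / 2) ^ Suc k"
begin

definition hump_sum :: "complex \<Rightarrow> complex" where
  "hump_sum z = (\<Sum>k. u k z)"

lemma half_powers_sums: "(\<lambda>k. c * (1 / 2) ^ Suc k) sums c"
  using sums_mult[OF power_half_series, of c] by simp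

lemma summable_humps:
  assumes "norm z \<le> \<rho> i"
  shows "summable (\<lambda>k. u k z)"
  using tail_le[OF _ assms]
  by (intro summable_comparison_test'[OF sums_summable[OF half_powers_sums], of "Suc i"]) auto

lemma norm_hump_sum_minus_partial_sum_le:
  assumes "norm z \<le> \<rho> i"
  shows "norm (hump_sum z - (\<Sum>k\<le>i. u k z)) \<le> c"
proof -
  let ?h = "\<lambda>k. c * (1 / 2) ^ Suc k"
  have "hump_sum z - (\<Sum>k\<le>i. u k z) = (\<Sum>k. u (k + Suc i) z)"
    unfolding hump_sum_def
    by (subst suminf_minus_initial_segment[OF summable_humps[OF assms]])
       (simp add: lessThan_Suc_atMost)
  also have "norm \<dots> \<le> (\<Sum>k. ?h (k + Suc i))"
    by (intro norm_suminf_le summable_ignore_initial_segment sums_summable[OF half_powers_sums]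
        tail_le[OF _ assms]) simp
  also have "\<dots> = c - (\<Sum>k<Suc i. ?h k)"
    using half_powers_sums
    by (subst suminf_minus_initial_segment) (auto simp: sums_iff simp del: power_Suc)
  also have "\<dots> \<le> c"
    using c_gt_0 sum_nonneg[of "{..<Suc i}" ?h] by simp
  finally show ?thesis .
qed

lemma hump_sum_holomorphic: "hump_sum holomorphic_on unit_disc"
proof (rule holomorphic_uniform_sequence[where f = "\<lambda>m z. \<Sum>k<m. u k z"])
  show "(\<lambda>z. \<Sum>k<m. u k z) holomorphic_on unit_disc" for m
    by (intro holomorphic_intros hump_holomorphic[OF hump])
  fix z :: complex assume "z \<in> unit_disc"
  define s where "s = (1 + norm z) / 2"
  have s: "norm z < s" "s < 1"
    using \<open>z \<in> unit_disc\<close> by (auto simp: s_def)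
  obtain i where i: "s \<le> \<rho> i"
    using \<rho>_exhausts[OF s(2)] by blast
  have sub: "norm w \<le> s" if "w \<in> cball z (s - norm z)" for w
    using that norm_triangle_ineq2[of w z] by (auto simp: dist_norm norm_minus_commute)
  have "uniform_limit (cball z (s - norm z)) (\<lambda>m z. \<Sum>k<m. u k z) hump_sum sequentially"
    unfolding hump_sum_def[abs_def]
  proof (rule Weierstrass_m_test_ev)
    show "\<forall>\<^sub>F k in sequentially. \<forall>w\<in>cball z (s - norm z). norm (u k w) \<le> c * (1 / 2) ^ Suc k"
      using eventually_gt_at_top[of i]
      by eventually_elim (use tail_le sub i order_trans in blast)
  qed (rule sums_summable[OF half_powers_sums])
  moreover have "cball z (s - norm z) \<subseteq> unit_disc"
    using sub s by fastforce
  ultimately show "\<exists>d>0. cball z d \<subseteq> unit_disc \<and>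
      uniform_limit (cball z d) (\<lambda>m z. \<Sum>k<m. u k z) hump_sum sequentially"
    using s by (intro exI[of _ "s - norm z"]) auto
qed auto

lemma weighted_partial_sum_le:
  assumes z: "z \<in> unit_disc" and k: "\<And>l. l < k \<Longrightarrow> \<rho> l < norm z"
  shows "(1 - norm z) powr \<alpha> * (\<Sum>i\<le>k. norm (u i z)) \<le> 2 * A + c"
proof (cases k)
  case 0
  then show ?thesis
    using hump_growth[OF hump[of 0] z] hump_bound_nonneg[OF hump[of 0]] c_gt_0 by simp
next
  case (Suc l)
  have "1 - norm z \<le> 1 - r l"
    using k[of l] Suc r_le_\<rho>[of l] by simp
  then have "(1 - norm z) powr \<alpha> * (\<Sum>i<l. norm (u i z)) \<le> (1 - r l) powr \<alpha> * (\<Sum>i<l. norm (u i z))"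
    using z \<alpha>_ge_0 by (intro mult_right_mono powr_mono2 sum_nonneg) auto
  then show ?thesis
    using hump_growth[OF hump[of l] z] hump_growth[OF hump[of k] z] head_le[OF z, of l] Suc
    by (simp add: lessThan_Suc_atMost[symmetric] distrib_left)
qed

lemma hump_sum_growth:
  assumes z: "z \<in> unit_disc"
  shows "(1 - norm z) powr \<alpha> * norm (hump_sum z) \<le> 2 * A + 2 * c"
proof -
  define k where "k = (LEAST k. norm z \<le> \<rho> k)"
  have k: "norm z \<le> \<rho> k"
    unfolding k_def using \<rho>_exhausts[of "norm z"] z by (auto intro: LeastI)
  have least: "\<rho> l < norm z" if "l < k" for l
    using that not_less_Least[of l "\<lambda>k. norm z \<le> \<rho> k"] unfolding k_def by simp
  have "norm (hump_sum z) \<le> norm (\<Sum>i\<le>k. u i z) + norm (hump_sum z - (\<Sum>i\<le>k. u i z))"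
    by (metis add.commute diff_add_cancel norm_triangle_ineq)
  also have "\<dots> \<le> (\<Sum>i\<le>k. norm (u i z)) + c"
    by (intro add_mono norm_sum norm_hump_sum_minus_partial_sum_le[OF k])
  finally have "(1 - norm z) powr \<alpha> * norm (hump_sum z)
      \<le> (1 - norm z) powr \<alpha> * ((\<Sum>i\<le>k. norm (u i z)) + c)"
    by (intro mult_left_mono) auto
  moreover have "(1 - norm z) powr \<alpha> * c \<le> 1 * c"
    using z c_gt_0 \<alpha>_ge_0 by (intro mult_right_mono powr_le1) auto
  ultimately show ?thesis
    using weighted_partial_sum_le[OF z, of k] least by (simp add: distrib_left)
qed

lemma hump_sum_approx:
  assumes z: "norm z \<le> \<rho> k"
  shows "(1 - r k) powr \<alpha> * norm (hump_sum z - u k z) \<le> 2 * c"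
proof -
  let ?s = "(1 - r k) powr \<alpha>"
  have "hump_sum z - u k z = (\<Sum>i<k. u i z) + (hump_sum z - (\<Sum>i\<le>k. u i z))"
    by (simp add: lessThan_Suc_atMost[symmetric])
  also have "norm \<dots> \<le> (\<Sum>i<k. norm (u i z)) + c"
    by (intro order_trans[OF norm_triangle_ineq] add_mono norm_sum
        norm_hump_sum_minus_partial_sum_le[OF z])
  finally have "?s * norm (hump_sum z - u k z) \<le> ?s * ((\<Sum>i<k. norm (u i z)) + c)"
    by (intro mult_left_mono) auto
  moreover have "?s * c \<le> 1 * c"
    using r_ge_0[of k] r_le_\<rho>[of k] \<rho>_less_1[of k] c_gt_0 \<alpha>_ge_0
    by (intro mult_right_mono powr_le1) auto
  ultimately show ?thesis
    using head_le[of z k] z \<rho>_less_1[of k] by (simp add: distrib_left)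
qed

lemma hump_sum_displacement_le:
  assumes w: "norm w \<le> \<rho> k" and z: "norm z \<le> \<rho> k"
  shows "(1 - r k) powr \<alpha> * norm ((hump_sum w - hump_sum z) - (u k w - u k z)) \<le> 4 * c"
    and "(1 - r k) powr \<alpha> * norm (hump_sum w - hump_sum z) \<le> 2 * A + 4 * c"
proof -
  let ?s = "(1 - r k) powr \<alpha>"
  have "norm ((hump_sum w - hump_sum z) - (u k w - u k z))
      \<le> norm (hump_sum w - u k w) + norm (hump_sum z - u k z)"
    using norm_triangle_ineq4[of "hump_sum w - u k w" "hump_sum z - u k z"]
    by (simp add: algebra_simps)
  then have "?s * norm ((hump_sum w - hump_sum z) - (u k w - u k z))
      \<le> ?s * (norm (hump_sum w - u k w) + norm (hump_sum z - u k z))"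
    by (intro mult_left_mono) auto
  then show approx: "?s * norm ((hump_sum w - hump_sum z) - (u k w - u k z)) \<le> 4 * c"
    using hump_sum_approx[OF w] hump_sum_approx[OF z] by (simp add: distrib_left)
  have "norm (hump_sum w - hump_sum z)
      \<le> norm (u k w) + norm (u k z) + norm ((hump_sum w - hump_sum z) - (u k w - u k z))"
    using norm_triangle_ineq[of "u k w - u k z" "(hump_sum w - hump_sum z) - (u k w - u k z)"]
      norm_triangle_ineq4[of "u k w" "u k z"] by simp
  then have "?s * norm (hump_sum w - hump_sum z)
      \<le> ?s * (norm (u k w) + norm (u k z) + norm ((hump_sum w - hump_sum z) - (u k w - u k z)))"
    by (intro mult_left_mono) auto
  then show "?s * norm (hump_sum w - hump_sum z) \<le> 2 * A + 4 * c"
    using approx hump_peak[OF hump, of w k] hump_peak[OF hump, of z k] w z \<rho>_less_1[of k]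
    by (simp add: distrib_left)
qed

end

lemma ex_radius_near_1:
  fixes \<alpha> c D :: real
  assumes \<alpha>: "0 < \<alpha>" and c: "0 < c" and X: "finite X" "\<And>x. x \<in> X \<Longrightarrow> x < 1"
  shows "\<exists>R<1. (\<forall>x\<in>X. x < R) \<and> (1 - R) powr \<alpha> * D < c"
proof -
  have "((\<lambda>R. (1 - R) powr \<alpha> * D) \<longlongrightarrow> 0) (at_left 1)"
    using \<alpha> by real_asymp
  then have "\<forall>\<^sub>F R in at_left 1. (1 - R) powr \<alpha> * D < c"
    using c by (rule order_tendstoD)
  moreover have "\<forall>\<^sub>F R in at_left 1. x < R" if "x \<in> X" for x
    using eventually_at_left_real[OF X(2)[OF that]] by eventually_elim simp
  then have "\<forall>\<^sub>F R in at_left 1. \<forall>x\<in>X. x < R"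
    using X(1) by (intro eventually_ball_finite ballI)
  moreover have "\<forall>\<^sub>F R in at_left (1::real). R < 1"
    by (simp add: eventually_at_filter)
  ultimately have "\<forall>\<^sub>F R in at_left 1. R < 1 \<and> (\<forall>x\<in>X. x < R) \<and> (1 - R) powr \<alpha> * D < c"
    by eventually_elim blast
  then show ?thesis
    by (rule eventually_happens'[OF trivial_limit_at_left_real])
qed

definition hump_beyond ::
  "real \<Rightarrow> real \<Rightarrow> real \<Rightarrow> real \<Rightarrow> (complex \<Rightarrow> complex) \<Rightarrow> real \<Rightarrow> real \<Rightarrow> bool" where
  "hump_beyond \<alpha> A R \<epsilon> u r \<rho> \<longleftrightarrow> hump \<alpha> A r u \<and> R \<le> r \<and> r \<le> \<rho> \<and> \<rho> < 1 \<and>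
     (\<forall>z\<in>cball 0 R. norm (u z) \<le> \<epsilon>)"

definition next_hump ::
  "real \<Rightarrow> real \<Rightarrow> real \<Rightarrow> nat \<Rightarrow> (nat \<Rightarrow> complex \<Rightarrow> complex) \<Rightarrow> (nat \<Rightarrow> real) \<Rightarrow>
   (complex \<Rightarrow> complex) \<Rightarrow> real \<Rightarrow> real \<Rightarrow> bool" where
  "next_hump \<alpha> A c k v \<sigma> u r \<rho> \<longleftrightarrow>
     hump \<alpha> A r u \<and> 1 - 1 / real (Suc k) \<le> r \<and> r \<le> \<rho> \<and> \<rho> < 1 \<and>
     (\<forall>z\<in>unit_disc. (1 - r) powr \<alpha> * (\<Sum>i<k. norm (v i z)) \<le> c) \<and>
     (\<forall>i<k. \<forall>z. norm z \<le> \<sigma> i \<longrightarrow> norm (u z) \<le> c * (1 / 2) ^ Suc k)"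

lemma ex_next_hump:
  fixes Q :: "(complex \<Rightarrow> complex) \<Rightarrow> real \<Rightarrow> real \<Rightarrow> bool"
  assumes \<alpha>: "0 < \<alpha>" and c: "0 < c"
    and ex_hump: "\<And>R \<epsilon>. R < 1 \<Longrightarrow> 0 < \<epsilon> \<Longrightarrow> \<exists>u r \<rho>. hump_beyond \<alpha> A R \<epsilon> u r \<rho> \<and> Q u r \<rho>"
    and prev: "\<And>i. i < k \<Longrightarrow> hump \<alpha> A (s i) (v i)" "\<And>i. i < k \<Longrightarrow> s i \<le> \<sigma> i" "\<And>i. i < k \<Longrightarrow> \<sigma> i < 1"
  shows "\<exists>u r \<rho>. next_hump \<alpha> A c k v \<sigma> u r \<rho> \<and> Q u r \<rho>"
proof -
  define D where "D = (\<Sum>i<k. A / (1 - s i) powr \<alpha>)"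
  have D: "(\<Sum>i<k. norm (v i z)) \<le> D" if z: "z \<in> unit_disc" for z
    unfolding D_def
  proof (rule sum_mono)
    fix i assume "i \<in> {..<k}"
    with prev[of i] show "norm (v i z) \<le> A / (1 - s i) powr \<alpha>"
      using hump_peak[of \<alpha> A "s i" "v i" z] z by (simp add: field_simps)
  qed
  have "\<exists>R<1. (\<forall>x\<in>insert (1 - 1 / real (Suc k)) (\<sigma> ` {..<k}). x < R) \<and> (1 - R) powr \<alpha> * D < c"
    using prev(3) by (intro ex_radius_near_1 \<alpha> c) auto
  then obtain R where R: "R < 1" "1 - 1 / real (Suc k) < R" "\<And>i. i < k \<Longrightarrow> \<sigma> i < R"
      "(1 - R) powr \<alpha> * D < c"
    by auto
  have "0 < c * (1 / 2) ^ Suc k"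
    using c by simp
  then obtain u r \<rho> where u: "hump \<alpha> A r u" "R \<le> r" "r \<le> \<rho>" "\<rho> < 1" "Q u r \<rho>"
      "\<And>z. z \<in> cball 0 R \<Longrightarrow> norm (u z) \<le> c * (1 / 2) ^ Suc k"
    using ex_hump[OF R(1)] unfolding hump_beyond_def by blast
  have "(1 - r) powr \<alpha> * (\<Sum>i<k. norm (v i z)) \<le> c" if "z \<in> unit_disc" for z
  proof -
    have "(1 - r) powr \<alpha> * (\<Sum>i<k. norm (v i z)) \<le> (1 - R) powr \<alpha> * D"
      using u \<alpha> D[OF that] by (intro mult_mono powr_mono2 sum_nonneg) auto
    with R(4) show ?thesis
      by simp
  qed
  moreover have "norm (u z) \<le> c * (1 / 2) ^ Suc k" if "i < k" "norm z \<le> \<sigma> i" for i z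
    using R(3)[OF that(1)] that(2) by (intro u(6)) auto
  ultimately have "next_hump \<alpha> A c k v \<sigma> u r \<rho>"
    using u R(2) by (simp add: next_hump_def)
  with u(5) show ?thesis
    by blast
qed

lemma gliding_humps_of_next_humps:
  assumes \<alpha>: "0 \<le> \<alpha>" and c: "0 < c" and humps: "\<And>k. next_hump \<alpha> A c k u \<rho> (u k) (r k) (\<rho> k)"
  shows "gliding_humps \<alpha> A c u r \<rho>"
proof
  note next_hump = humps[unfolded next_hump_def]
  have r: "1 - 1 / real (Suc k) \<le> r k" and r_le_\<rho>: "r k \<le> \<rho> k" for k
    using next_hump by blast+
  then show "r k \<le> \<rho> k" for k
    by blast
  have "0 \<le> 1 - 1 / real (Suc k)" for k
    by simp
  with r show "0 \<le> r k" for k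
    using order_trans by blast
  show "\<exists>k. x \<le> \<rho> k" if "x < 1" for x
  proof -
    have "\<forall>\<^sub>F k in sequentially. x < 1 - 1 / real (Suc k)"
      using that by real_asymp
    then obtain k where "x < 1 - 1 / real (Suc k)"
      using eventually_happens'[OF sequentially_bot] by blast
    with r[of k] r_le_\<rho>[of k] show ?thesis
      by (intro exI[of _ k]) linarith
  qed
  show "hump \<alpha> A (r k) (u k)" "\<rho> k < 1" for k
    using next_hump by blast+
  show "(1 - r k) powr \<alpha> * (\<Sum>i<k. norm (u i z)) \<le> c" if "z \<in> unit_disc" for z k
    using next_hump that by blast
  show "norm (u k z) \<le> c * (1 / 2) ^ Suc k" if "i < k" "norm z \<le> \<rho> i" for i k z
    using next_hump that by blast
qed (use \<alpha> c in auto)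

lemma ex_gliding_humps:
  fixes Q :: "nat \<Rightarrow> (complex \<Rightarrow> complex) \<Rightarrow> real \<Rightarrow> real \<Rightarrow> bool"
  assumes \<alpha>: "0 < \<alpha>" and c: "0 < c"
    and ex_hump: "\<And>k R \<epsilon>. R < 1 \<Longrightarrow> 0 < \<epsilon> \<Longrightarrow> \<exists>u r \<rho>. hump_beyond \<alpha> A R \<epsilon> u r \<rho> \<and> Q k u r \<rho>"
  shows "\<exists>u r \<rho>. gliding_humps \<alpha> A c u r \<rho> \<and> (\<forall>k. Q k (u k) (r k) (\<rho> k))"
proof -
  define chosen where "chosen f k = (\<lambda>(u, r, \<rho>).
      next_hump \<alpha> A c k (\<lambda>i. fst (f i)) (\<lambda>i. snd (snd (f i))) u r \<rho> \<and> Q k u r \<rho>)"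
    for f :: "nat \<Rightarrow> (complex \<Rightarrow> complex) \<times> real \<times> real" and k
  have "\<exists>f. \<forall>k. chosen f k (f k)"
  proof (rule dependent_wf_choice[OF wf_less_than])
    show "chosen f k x = chosen g k x" if "\<And>i. (i, k) \<in> less_than \<Longrightarrow> f i = g i" for f g k x
      using that unfolding chosen_def next_hump_def by (auto split: prod.splits)
  next
    fix k and f :: "nat \<Rightarrow> (complex \<Rightarrow> complex) \<times> real \<times> real"
    assume IH: "\<And>i. (i, k) \<in> less_than \<Longrightarrow> chosen f i (f i)"
    have "\<exists>u r \<rho>. next_hump \<alpha> A c k (\<lambda>i. fst (f i)) (\<lambda>i. snd (snd (f i))) u r \<rho> \<and> Q k u r \<rho>"
    proof (rule ex_next_hump[OF \<alpha> c ex_hump])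
      show "hump \<alpha> A (fst (snd (f i))) (fst (f i))" "fst (snd (f i)) \<le> snd (snd (f i))"
          "snd (snd (f i)) < 1" if "i < k" for i
        using IH[of i] that by (auto simp: chosen_def next_hump_def split: prod.splits)
    qed
    then show "\<exists>x. chosen f k x"
      unfolding chosen_def by auto
  qed
  then obtain f where f: "\<And>k. chosen f k (f k)"
    by blast
  define u r \<rho> where "u k = fst (f k)" and "r k = fst (snd (f k))" and "\<rho> k = snd (snd (f k))" for k
  have "chosen f k (u k, r k, \<rho> k)" for k
    using f by (simp add: u_def r_def \<rho>_def)
  then have "next_hump \<alpha> A c k u \<rho> (u k) (r k) (\<rho> k)" "Q k (u k) (r k) (\<rho> k)" for k
    unfolding chosen_def u_def[symmetric] \<rho>_def[symmetric] prod.case by blast+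
  then show ?thesis
    using gliding_humps_of_next_humps[OF less_imp_le[OF \<alpha>] c] by blast
qed

definition displaces ::
  "real \<Rightarrow> real \<Rightarrow> (complex \<Rightarrow> complex) \<Rightarrow> (complex \<Rightarrow> complex) \<Rightarrow> real \<Rightarrow> real \<Rightarrow> bool" where
  "displaces \<alpha> \<eta> \<phi> u r \<rho> \<longleftrightarrow> \<phi> ` cball 0 r \<subseteq> cball 0 \<rho> \<and>
     \<eta> \<le> (1 - r) powr \<alpha> * Mp 1 r (\<lambda>z. u (\<phi> z) - u z)"

lemma (in gliding_humps) Hnorm_hump_sum_displacement_ge:
  assumes hol: "\<phi> holomorphic_on unit_disc" and into: "\<phi> ` unit_disc \<subseteq> unit_disc"
    and disp: "displaces \<alpha> \<eta> \<phi> (u k) (r k) (\<rho> k)" and \<eta>: "8 * c \<le> \<eta>" and p: "0 < p"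
  shows "ereal (\<eta> / 4 * (\<eta> / (8 * A + 16 * c)) powr (1 / real_of_ereal p))
    \<le> Hnorm p \<alpha> (\<lambda>z. hump_sum (\<phi> z) - hump_sum z)"
proof -
  define s where "s = (1 - r k) powr \<alpha>"
  have r: "0 \<le> r k" "r k < 1"
    using r_ge_0[of k] r_le_\<rho>[of k] \<rho>_less_1[of k] by auto
  then have s: "0 < s"
    by (simp add: s_def)
  have cont: "continuous_on unit_disc (\<lambda>z. f (\<phi> z) - f z)" if "f holomorphic_on unit_disc" for f
    using holomorphic_on_compose_gen[OF hol that into] that
    by (intro holomorphic_on_imp_continuous_on holomorphic_on_diff) (simp_all add: o_def)
  have cont_circle: "continuous_on (sphere 0 (r k)) (\<lambda>z. f (\<phi> z) - f z)"
    if "f holomorphic_on unit_disc" for f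
    by (rule continuous_on_subset[OF cont[OF that]]) (use r in auto)
  have \<rho>: "norm (\<phi> z) \<le> \<rho> k" "norm z \<le> \<rho> k" if "norm z = r k" for z
    using disp that r_le_\<rho>[of k] by (auto simp: displaces_def image_subset_iff)
  have "norm ((u k (\<phi> z) - u k z) - (hump_sum (\<phi> z) - hump_sum z)) \<le> 4 * c / s"
    if "norm z = r k" for z
    using hump_sum_displacement_le(1)[OF \<rho>[OF that]] s
    by (simp add: s_def[symmetric] norm_minus_commute pos_le_divide_eq mult.commute)
  then have "Mp 1 (r k) (\<lambda>z. u k (\<phi> z) - u k z)
      \<le> Mp 1 (r k) (\<lambda>z. hump_sum (\<phi> z) - hump_sum z) + 4 * c / s"
    by (rule Mp_one_le_add[OF cont_circle[OF hump_holomorphic[OF hump]]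
          cont_circle[OF hump_sum_holomorphic] r(1)])
  then have "s * Mp 1 (r k) (\<lambda>z. u k (\<phi> z) - u k z)
      \<le> s * (Mp 1 (r k) (\<lambda>z. hump_sum (\<phi> z) - hump_sum z) + 4 * c / s)"
    using s by (intro mult_left_mono) auto
  then have "\<eta> / 2 \<le> (1 - r k) powr \<alpha> * Mp 1 (r k) (\<lambda>z. hump_sum (\<phi> z) - hump_sum z)"
    using disp s \<eta> by (simp add: displaces_def s_def[symmetric] distrib_left)
  then have "ereal (\<eta> / 2 / 2 * (\<eta> / 2 / (2 * (2 * A + 4 * c))) powr (1 / real_of_ereal p))
      \<le> Hnorm p \<alpha> (\<lambda>z. hump_sum (\<phi> z) - hump_sum z)"
    using hump_bound_nonneg[OF hump] \<eta> c_gt_0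
    by (intro Hnorm_ge[OF cont[OF hump_sum_holomorphic] p r] hump_sum_displacement_le(2)[OF \<rho>]) auto
  then show ?thesis
    by (simp add: algebra_simps)
qed

subsection \<open>Monomials as humps\<close>

lemma powr_mult_power_le:
  fixes \<alpha> r :: real
  assumes "0 < \<alpha>" "0 \<le> r" "r \<le> 1"
  shows "(1 - r) powr \<alpha> * (real N powr \<alpha> * r ^ N) \<le> \<alpha> powr \<alpha>"
proof -
  define y where "y = (1 - r) * real N"
  have y: "0 \<le> y"
    using assms by (simp add: y_def)
  have "(y / \<alpha>) powr \<alpha> \<le> exp (y / \<alpha>) powr \<alpha>"
    using y assms order_trans[OF _ exp_ge_add_one_self[of "y / \<alpha>"]] by (intro powr_mono2) auto
  then have powr_le_exp: "y powr \<alpha> \<le> \<alpha> powr \<alpha> * exp y"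
    using y assms by (simp add: powr_divide powr_def[of "exp _"] field_simps)
  have "r ^ N \<le> exp (- (1 - r)) ^ N"
    using assms exp_ge_add_one_self[of "- (1 - r)"] by (intro power_mono) auto
  also have "\<dots> = exp (- y)"
    by (simp add: exp_of_nat_mult[symmetric] y_def algebra_simps)
  finally have "y powr \<alpha> * r ^ N \<le> (\<alpha> powr \<alpha> * exp y) * exp (- y)"
    using powr_le_exp assms by (intro mult_mono) auto
  then show ?thesis
    using assms by (simp add: y_def powr_mult mult.assoc exp_minus)
qed

definition scaled_monomial :: "real \<Rightarrow> nat \<Rightarrow> complex \<Rightarrow> complex" where
  "scaled_monomial \<alpha> N z = of_real (real N powr \<alpha>) * z ^ N"

lemma norm_scaled_monomial: "norm (scaled_monomial \<alpha> N z) = real N powr \<alpha> * norm z ^ N"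
  by (simp add: scaled_monomial_def norm_mult norm_power)

lemma hump_scaled_monomial:
  assumes \<alpha>: "0 < \<alpha>" and N: "0 < n" "N \<le> 2 * n"
  shows "hump \<alpha> (max (\<alpha> powr \<alpha>) (2 powr \<alpha>)) (1 - 1 / real n) (scaled_monomial \<alpha> N)"
  unfolding hump_def
proof (intro conjI ballI)
  show "scaled_monomial \<alpha> N holomorphic_on unit_disc"
    unfolding scaled_monomial_def[abs_def] by (intro holomorphic_intros)
  fix z :: complex assume z: "z \<in> unit_disc"
  show "(1 - norm z) powr \<alpha> * norm (scaled_monomial \<alpha> N z) \<le> max (\<alpha> powr \<alpha>) (2 powr \<alpha>)"
    using powr_mult_power_le[OF \<alpha>, of "norm z" N] z
    by (simp add: norm_scaled_monomial le_max_iff_disj)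
  have "real N / real n \<le> 2"
    using N by (simp add: field_simps)
  then have "(real N / real n) powr \<alpha> * norm z ^ N \<le> 2 powr \<alpha> * 1"
    using z \<alpha> by (intro mult_mono powr_mono2 power_le_one) auto
  then show "(1 - (1 - 1 / real n)) powr \<alpha> * norm (scaled_monomial \<alpha> N z)
      \<le> max (\<alpha> powr \<alpha>) (2 powr \<alpha>)"
    by (simp add: norm_scaled_monomial powr_divide le_max_iff_disj)
qed

lemma displaces_scaled_monomial:
  assumes \<alpha>: "0 \<le> \<alpha>" and N: "0 < n" "n \<le> N" and image: "\<phi> ` cball 0 (1 - 1 / real n) \<subseteq> cball 0 \<rho>"
    and \<eta>: "0 \<le> \<eta>" "\<eta> \<le> Mp 1 (1 - 1 / real n) (\<lambda>z. \<phi> z ^ N - z ^ N)"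
  shows "displaces \<alpha> \<eta> \<phi> (scaled_monomial \<alpha> N) (1 - 1 / real n) \<rho>"
proof -
  let ?M = "Mp 1 (1 - 1 / real n)"
  have "1 \<le> (real N / real n) powr \<alpha>"
    using N \<alpha> by (intro ge_one_powr_ge_zero) auto
  then have "1 * \<eta> \<le> (real N / real n) powr \<alpha> * ?M (\<lambda>z. \<phi> z ^ N - z ^ N)"
    using \<eta> by (intro mult_mono) auto
  also have "\<dots> = (1 - (1 - 1 / real n)) powr \<alpha>
      * ?M (\<lambda>z. scaled_monomial \<alpha> N (\<phi> z) - scaled_monomial \<alpha> N z)"
    by (simp add: scaled_monomial_def right_diff_distrib[symmetric] Mp_one_cmult powr_divide)
  finally show ?thesis
    using image by (simp add: displaces_def)
qed

lemma ex_self_map_image_bound: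
  assumes cont: "continuous_on unit_disc \<phi>" and into: "\<phi> ` unit_disc \<subseteq> unit_disc"
    and r: "0 \<le> r" "r < 1"
  shows "\<exists>\<rho>. r \<le> \<rho> \<and> \<rho> < 1 \<and> \<phi> ` cball 0 r \<subseteq> cball 0 \<rho>"
proof -
  have "continuous_on (cball 0 r) (\<lambda>z. norm (\<phi> z))"
    using r by (intro continuous_intros continuous_on_subset[OF cont]) auto
  then obtain x where x: "x \<in> cball 0 r" "\<And>z. z \<in> cball 0 r \<Longrightarrow> norm (\<phi> z) \<le> norm (\<phi> x)"
    using continuous_attains_sup[of "cball 0 r" "\<lambda>z. norm (\<phi> z)"] r by auto
  have "norm (\<phi> x) < 1"
    using x(1) r into by (auto simp: image_subset_iff)
  with x r show ?thesis
    by (intro exI[of _ "max r (norm (\<phi> x))"]) (auto simp: le_max_iff_disj)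
qed

lemma eventually_scaled_monomial_le:
  assumes \<alpha>: "0 < \<alpha>" and R: "R < 1" and \<epsilon>: "0 < \<epsilon>"
  shows "\<forall>\<^sub>F N in sequentially. \<forall>z\<in>cball 0 R. norm (scaled_monomial \<alpha> N z) \<le> \<epsilon>"
proof -
  define R' where "R' = max R (1 / 2)"
  have R': "R \<le> R'" "0 < R'" "R' < 1"
    using R by (auto simp: R'_def)
  have "(\<lambda>N. real N powr \<alpha> * R' ^ N) \<longlonglongrightarrow> 0"
    using \<alpha> R' by real_asymp
  then have "\<forall>\<^sub>F N in sequentially. real N powr \<alpha> * R' ^ N < \<epsilon>"
    using \<epsilon> by (rule order_tendstoD)
  then show ?thesis
  proof (eventually_elim, intro ballI)
    fix N and z :: complex assume small: "real N powr \<alpha> * R' ^ N < \<epsilon>" and z: "z \<in> cball 0 R"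
    have "real N powr \<alpha> * norm z ^ N \<le> real N powr \<alpha> * R' ^ N"
      using z R' by (intro mult_left_mono power_mono) auto
    with small show "norm (scaled_monomial \<alpha> N z) \<le> \<epsilon>"
      by (simp add: norm_scaled_monomial)
  qed
qed

lemma ex_displaced_hump:
  assumes \<alpha>: "0 < \<alpha>" and hol: "\<phi> holomorphic_on unit_disc" and into: "\<phi> ` unit_disc \<subseteq> unit_disc"
    and w: "w \<in> unit_disc" "\<phi> w \<noteq> w" and R: "R < 1" and \<epsilon>: "0 < \<epsilon>"
  shows "\<exists>u r \<rho>. hump_beyond \<alpha> (max (\<alpha> powr \<alpha>) (2 powr \<alpha>)) R \<epsilon> u r \<rho>
    \<and> displaces \<alpha> (exp (- 4) / 4) \<phi> u r \<rho>"
proof -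
  have "\<forall>\<^sub>F n in sequentially. \<forall>N\<ge>n. \<forall>z\<in>cball 0 R. norm (scaled_monomial \<alpha> N z) \<le> \<epsilon>"
    using eventually_scaled_monomial_le[OF \<alpha> R \<epsilon>] by (rule eventually_all_ge_at_top)
  moreover have "\<forall>\<^sub>F n in sequentially. R < 1 - 1 / real n"
    using R by real_asymp
  ultimately have "\<forall>\<^sub>F n in sequentially.
      (\<exists>N\<in>{n..<2*n}. exp (- 4) / 4 \<le> Mp 1 (1 - 1 / real n) (\<lambda>z. \<phi> z ^ N - z ^ N))
      \<and> (\<forall>N\<ge>n. \<forall>z\<in>cball 0 R. norm (scaled_monomial \<alpha> N z) \<le> \<epsilon>) \<and> R < 1 - 1 / real n \<and> 0 < n"
    using eventually_gt_at_top[of 0] eventually_power_displacement_ge[OF hol into w]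
    by eventually_elim blast
  then obtain n where n: "R < 1 - 1 / real n" "0 < n"
    and displaced: "\<exists>N\<in>{n..<2*n}. exp (- 4) / 4 \<le> Mp 1 (1 - 1 / real n) (\<lambda>z. \<phi> z ^ N - z ^ N)"
    and all_small: "\<forall>N\<ge>n. \<forall>z\<in>cball 0 R. norm (scaled_monomial \<alpha> N z) \<le> \<epsilon>"
    using eventually_happens'[OF sequentially_bot] by blast
  from displaced obtain N where N: "n \<le> N" "N < 2 * n"
    and mean: "exp (- 4) / 4 \<le> Mp 1 (1 - 1 / real n) (\<lambda>z. \<phi> z ^ N - z ^ N)"
    by auto
  have small: "\<forall>z\<in>cball 0 R. norm (scaled_monomial \<alpha> N z) \<le> \<epsilon>"
    using all_small N(1) by blast
  obtain \<rho> where \<rho>: "1 - 1 / real n \<le> \<rho>" "\<rho> < 1" "\<phi> ` cball 0 (1 - 1 / real n) \<subseteq> cball 0 \<rho>"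
    using ex_self_map_image_bound[OF holomorphic_on_imp_continuous_on[OF hol] into,
        of "1 - 1 / real n"] n(2) by auto
  have "hump \<alpha> (max (\<alpha> powr \<alpha>) (2 powr \<alpha>)) (1 - 1 / real n) (scaled_monomial \<alpha> N)"
    using \<alpha> n N by (intro hump_scaled_monomial) auto
  moreover have "displaces \<alpha> (exp (- 4) / 4) \<phi> (scaled_monomial \<alpha> N) (1 - 1 / real n) \<rho>"
    using \<alpha> n N \<rho> mean by (intro displaces_scaled_monomial) auto
  ultimately show ?thesis
    using \<rho> small less_imp_le[OF n(1)] unfolding hump_beyond_def by blast
qed

subsection \<open>Sequences of self-maps and semigroups\<close>

lemma ex_function_displaced_by_self_maps:
  fixes \<psi> :: "nat \<Rightarrow> complex \<Rightarrow> complex"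
  assumes \<alpha>: "0 < \<alpha>" and hol: "\<And>k. \<psi> k holomorphic_on unit_disc"
    and into: "\<And>k. \<psi> k ` unit_disc \<subseteq> unit_disc"
    and moves: "\<And>k. \<exists>w\<in>unit_disc. \<psi> k w \<noteq> w"
  shows "\<exists>f. f holomorphic_on unit_disc
    \<and> (\<exists>C. \<forall>z\<in>unit_disc. (1 - norm z) powr \<alpha> * norm (f z) \<le> C)
    \<and> (\<forall>p>0. \<exists>d>0. \<forall>k. ereal d \<le> Hnorm p \<alpha> (\<lambda>z. f (\<psi> k z) - f z))"
proof -
  define A where "A = max (\<alpha> powr \<alpha>) (2 powr \<alpha>)"
  define \<eta> :: real where "\<eta> = exp (- 4) / 4"
  define c where "c = \<eta> / 8"
  have pos: "0 < \<eta>" "0 < c" "0 < A"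
    using \<alpha> by (auto simp: \<eta>_def c_def A_def less_max_iff_disj)
  have "\<exists>u r \<rho>. hump_beyond \<alpha> A R \<epsilon> u r \<rho> \<and> displaces \<alpha> \<eta> (\<psi> k) u r \<rho>"
    if "R < 1" "0 < \<epsilon>" for k R \<epsilon>
    using moves[of k] ex_displaced_hump[OF \<alpha> hol into _ _ that] unfolding A_def \<eta>_def by blast
  then have "\<exists>u r \<rho>. gliding_humps \<alpha> A c u r \<rho> \<and> (\<forall>k. displaces \<alpha> \<eta> (\<psi> k) (u k) (r k) (\<rho> k))"
    by (rule ex_gliding_humps[OF \<alpha> pos(2)])
  then obtain u r \<rho> where humps: "gliding_humps \<alpha> A c u r \<rho>"
    and disp: "\<And>k. displaces \<alpha> \<eta> (\<psi> k) (u k) (r k) (\<rho> k)"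
    by blast
  interpret gliding_humps \<alpha> A c u r \<rho>
    by (rule humps)
  show ?thesis
  proof (intro exI[of _ hump_sum] conjI allI impI)
    show "\<exists>C. \<forall>z\<in>unit_disc. (1 - norm z) powr \<alpha> * norm (hump_sum z) \<le> C"
      using hump_sum_growth by blast
    fix p :: ereal assume p: "0 < p"
    define d where "d = \<eta> / 4 * (\<eta> / (8 * A + 16 * c)) powr (1 / real_of_ereal p)"
    have "0 < d"
      using pos by (simp add: d_def)
    moreover have "ereal d \<le> Hnorm p \<alpha> (\<lambda>z. hump_sum (\<psi> k z) - hump_sum z)" for k
      unfolding d_def
      by (rule Hnorm_hump_sum_displacement_ge[OF hol into disp _ p]) (simp add: c_def)
    ultimately show "\<exists>d>0. \<forall>k. ereal d \<le> Hnorm p \<alpha> (\<lambda>z. hump_sum (\<psi> k z) - hump_sum z)"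
      by blast
  qed (rule hump_sum_holomorphic)
qed

text \<open>A point fixed by \<^term>\<open>\<phi> (T / 2)\<close> is fixed by \<^term>\<open>\<phi> T\<close>, so the times can be halved.\<close>

lemma nontrivial_semigroup_moves_at_small_times:
  assumes semi: "analytic_semigroup \<phi>" and nontriv: "\<not> trivial_semigroup \<phi>"
  obtains t z where "\<And>k. 0 < t k" "filterlim t (at_right 0) sequentially"
    "z \<in> unit_disc" "\<And>k. \<phi> (t k) z \<noteq> z"
proof -
  obtain T z where T: "0 \<le> T" "z \<in> unit_disc" "\<phi> T z \<noteq> z"
    using nontriv by (auto simp: trivial_semigroup_def)
  then have "0 < T"
    using semi by (cases "T = 0") (auto simp: analytic_semigroup_def)
  have double: "\<phi> (h + h) z = \<phi> h (\<phi> h z)" if "0 \<le> h" for h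
    using semi T(2) that unfolding analytic_semigroup_def by blast
  have "\<phi> (T / 2 ^ k) z \<noteq> z" for k
  proof (induction k)
    case (Suc k)
    have "T / 2 ^ Suc k + T / 2 ^ Suc k = T / 2 ^ k"
      by (simp add: field_simps)
    with Suc show ?case
      using double[of "T / 2 ^ Suc k"] T(1) by auto
  qed (use T in simp)
  moreover have "filterlim (\<lambda>k. T / 2 ^ k) (at_right 0) sequentially"
    using \<open>0 < T\<close> by real_asymp
  ultimately show ?thesis
    using that[of "\<lambda>k. T / 2 ^ k" z] \<open>0 < T\<close> T(2) by simp
qed

lemma not_mem_strong_cont_spaceI:
  assumes t: "filterlim t (at_right 0) F" "F \<noteq> bot" and "0 < d"
    and d: "\<And>k. ereal d \<le> Hnorm p \<alpha> (\<lambda>z. f (\<phi> (t k) z) - f z)"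
  shows "f \<notin> strong_cont_space \<phi> p \<alpha>"
proof
  assume "f \<in> strong_cont_space \<phi> p \<alpha>"
  then have "((\<lambda>k. Hnorm p \<alpha> (\<lambda>z. f (\<phi> (t k) z) - f z)) \<longlongrightarrow> 0) F"
    using t(1) by (auto simp: strong_cont_space_def intro: filterlim_compose)
  then have "ereal d \<le> 0"
    using d t(2) by (intro tendsto_lowerbound) auto
  with \<open>0 < d\<close> show False
    by simp
qed

theorem theorem6p2:
  fixes p :: ereal and \<alpha> :: real and \<phi> :: "real \<Rightarrow> complex \<Rightarrow> complex"
  assumes "0 < p" and "0 < \<alpha>"
    and "analytic_semigroup \<phi>" and "\<not> trivial_semigroup \<phi>"
  shows "strong_cont_space \<phi> p \<alpha> \<subset> Hspace p \<alpha>"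
proof -
  obtain t z where t: "\<And>k. 0 < t k" "filterlim t (at_right 0) sequentially"
    and z: "z \<in> unit_disc" "\<And>k. \<phi> (t k) z \<noteq> z"
    using nontrivial_semigroup_moves_at_small_times[OF assms(3,4)] by blast
  have "\<phi> (t k) holomorphic_on unit_disc" "\<phi> (t k) ` unit_disc \<subseteq> unit_disc" for k
    using assms(3) t(1)[of k] by (auto simp: analytic_semigroup_def)
  then obtain f C d where f: "f holomorphic_on unit_disc"
      "\<And>z. z \<in> unit_disc \<Longrightarrow> (1 - norm z) powr \<alpha> * norm (f z) \<le> C"
    and d: "0 < d" "\<And>k. ereal d \<le> Hnorm p \<alpha> (\<lambda>z. f (\<phi> (t k) z) - f z)"
    using ex_function_displaced_by_self_maps[OF assms(2), of "\<lambda>k. \<phi> (t k)"] z assms(1) by blast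
  have "f \<in> Hspace p \<alpha>"
    using f(1) assms(1) f(2) by (rule mem_HspaceI)
  moreover have "f \<notin> strong_cont_space \<phi> p \<alpha>"
    using t(2) sequentially_bot d by (rule not_mem_strong_cont_spaceI)
  ultimately show ?thesis
    by (auto simp: strong_cont_space_def)
qed

end
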